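(* A graph class $\mathcal C$ has bounded clique-width if and only if $\sup_{G\in\mathcal C}\mathrm{mw}_\infty(G)<\infty$.
   Context: Graphs are finite, simple and undirected: $G=(V,E(G))$ with $E(G)\subseteq\binom V2$. Clique-width is the standard graph parameter; a class has bounded clique-width if the clique-width of its graphs is bounded by a constant. Radius-$\infty$ merge-width. A construction sequence on $V$ is a sequence of steps maintaining a partition $\mathcal P$ of $V$ and a partition of $\binom V2$ into edges $E$, non-edges $N$, and unresolved pairs $U$. Initially $\mathcal P$ is the partition into singletons and $U=\binom V2$. In each step one of three operations is performed: merge two parts $A,B\in\mathcal P$, replacing them by $A\cup B$; resolve positively a pair of parts $A,B\in\mathcal P$ (possibly $A=B$), moving all $\{a,b\}\in U$ with $a\in A,b\in B$ from $U$ to $E$; or resolve negatively such a pair of parts, moving these pairs from $U$ to $N$. In the end $\mathcal P$ has one part and $U=\emptyset$; it is then a construction sequence of the graph $(V,E)$. Its radius-$\infty$ width is the least $k$ such that at every step, for every $v\in V$, at most $k$ parts of the current $\mathcal P$ contain a vertex reachable from $v$ by a path (of arbitrary length) in the graph $(V,E\cup N)$ for the current $E,N$. $\mathrm{mw}_\infty(G)$ is the least radius-$\infty$ width of a construction sequence of $G$. *)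

theory Defs
  imports "HOL-Library.Ramsey" "HOL-Library.Extended_Nat"
begin

type_synonym 'a graph = "'a set \<times> 'a set set"

text \<open>\<open>[V]\<^bsup>2\<^esup>\<close> is the library notation for the set of 2-element subsets of \<open>V\<close>.\<close>

definition simple_graph :: "'a graph \<Rightarrow> bool" where
  "simple_graph G \<longleftrightarrow> (case G of (V, E) \<Rightarrow> finite V \<and> E \<subseteq> [V]\<^bsup>2\<^esup>)"

definition pairs_between :: "'a set \<Rightarrow> 'a set \<Rightarrow> 'a set set" where
  "pairs_between A B = {{a, b} | a b. a \<in> A \<and> b \<in> B}"


section \<open>Clique-width\<close>

text \<open>
  \<open>k_expression k V E lab\<close>: some k-expression, with labels \<open>0, \<dots>, k - 1\<close>, evaluates to the graph
  \<open>(V, E)\<close> with vertex labelling \<open>lab\<close>; only the values of \<open>lab\<close> on \<open>V\<close> matter. Vertices are named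
  when they are created, so a graph is isomorphic to the value of a k-expression iff it is
  itself the value of one. The constant for the empty graph gives that graph clique-width 0 and
  does not affect any other graph.
\<close>

inductive k_expression :: "nat \<Rightarrow> 'a set \<Rightarrow> 'a set set \<Rightarrow> ('a \<Rightarrow> nat) \<Rightarrow> bool" for k where
  empty: "k_expression k {} {} lab"
| vertex: "i < k \<Longrightarrow> k_expression k {v} {} (\<lambda>_. i)"
| disjoint_union:
    "\<lbrakk>k_expression k V1 E1 lab1; k_expression k V2 E2 lab2; V1 \<inter> V2 = {}\<rbrakk>
      \<Longrightarrow> k_expression k (V1 \<union> V2) (E1 \<union> E2) (\<lambda>v. if v \<in> V1 then lab1 v else lab2 v)"
| relabel:
    "\<lbrakk>k_expression k V E lab; i < k; j < k\<rbrakk>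
      \<Longrightarrow> k_expression k V E (\<lambda>v. if lab v = i then j else lab v)"
| join:
    "\<lbrakk>k_expression k V E lab; i < k; j < k; i \<noteq> j\<rbrakk>
      \<Longrightarrow> k_expression k V (E \<union> pairs_between {v \<in> V. lab v = i} {v \<in> V. lab v = j}) lab"

text \<open>
  Here and for the merge-width below, the infimum is taken in the extended naturals, so a minimum
  over an empty set would be infinite and not 0.
\<close>

definition clique_width :: "'a graph \<Rightarrow> enat" where
  "clique_width G = Inf {enat k | k. \<exists>lab. k_expression k (fst G) (snd G) lab}"

definition bounded_clique_width :: "'a graph set \<Rightarrow> bool" where
  "bounded_clique_width C \<longleftrightarrow> (\<exists>k::nat. \<forall>G\<in>C. clique_width G \<le> enat k)"


section \<open>Radius-infinity merge-width\<close>

text \<open>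
  A state \<open>(P, E, N)\<close> consists of the current partition, edges and non-edges; the unresolved pairs
  are the remaining elements of \<open>[V]\<^bsup>2\<^esup>\<close>.
\<close>

type_synonym 'a state = "'a set set \<times> 'a set set \<times> 'a set set"

definition unresolved :: "'a set \<Rightarrow> 'a set set \<Rightarrow> 'a set set \<Rightarrow> 'a set set" where
  "unresolved V E N = [V]\<^bsup>2\<^esup> - (E \<union> N)"

inductive construction_step :: "'a set \<Rightarrow> 'a state \<Rightarrow> 'a state \<Rightarrow> bool" for V where
  merge:
    "\<lbrakk>A \<in> P; B \<in> P; A \<noteq> B\<rbrakk>
      \<Longrightarrow> construction_step V (P, E, N) (insert (A \<union> B) (P - {A, B}), E, N)"
| resolve_positively:
    "\<lbrakk>A \<in> P; B \<in> P\<rbrakk>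
      \<Longrightarrow> construction_step V (P, E, N) (P, E \<union> (pairs_between A B \<inter> unresolved V E N), N)"
| resolve_negatively:
    "\<lbrakk>A \<in> P; B \<in> P\<rbrakk>
      \<Longrightarrow> construction_step V (P, E, N) (P, E, N \<union> (pairs_between A B \<inter> unresolved V E N))"

text \<open>
  A construction sequence is represented by the list of its states. For \<open>V \<noteq> {}\<close>, the condition
  \<open>card P \<le> 1\<close> says that the final partition has exactly one part; the empty graph, whose vertex
  set has only the partition without parts, is thereby included.
\<close>

definition construction_sequence :: "'a graph \<Rightarrow> 'a state list \<Rightarrow> bool" where
  "construction_sequence G ss \<longleftrightarrow> (case G of (V, F) \<Rightarrow>
     ss \<noteq> [] \<and> hd ss = ((\<lambda>v. {v}) ` V, {}, {}) \<and>
     successively (construction_step V) ss \<and>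
     (case last ss of (P, E, N) \<Rightarrow> card P \<le> 1 \<and> unresolved V E N = {} \<and> E = F))"

definition reachable :: "'a set set \<Rightarrow> 'a \<Rightarrow> 'a \<Rightarrow> bool" where
  "reachable R v u \<longleftrightarrow> (v, u) \<in> {(x, y). {x, y} \<in> R}\<^sup>*"

definition reachable_parts :: "'a state \<Rightarrow> 'a \<Rightarrow> 'a set set" where
  "reachable_parts s v = (case s of (P, E, N) \<Rightarrow> {A \<in> P. \<exists>u\<in>A. reachable (E \<union> N) v u})"

definition radius_inf_width :: "'a set \<Rightarrow> 'a state list \<Rightarrow> nat" where
  "radius_inf_width V ss = (LEAST k. \<forall>s\<in>set ss. \<forall>v\<in>V. card (reachable_parts s v) \<le> k)"

definition mw_inf :: "'a graph \<Rightarrow> enat" where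
  "mw_inf G = Inf {enat (radius_inf_width (fst G) ss) | ss. construction_sequence G ss}"

end

theory Submission
  imports Defs "HOL-Library.Disjoint_Sets"
begin

text \<open>
  Both directions give linear bounds: \<open>mw_inf G \<le> 2 * clique_width G\<close> and
  \<open>clique_width G \<le> 4 * mw_inf G\<close>.

  From expressions to construction sequences: a construction sequence can imitate an expression by
  using the label classes as parts, with joins as positive resolutions. What is built for a
  subexpression is not connected to any other vertex by resolved pairs, so a vertex only reaches
  the label classes of the subexpression that is being processed; there are at most \<open>k\<close> of them,
  and \<open>2 * k\<close> while a disjoint union is formed (\<open>narrow_steps_if_k_expression\<close>). Non-edges are
  resolved only at the very end.

  From construction sequences to expressions: consider the connected components of the graph of
  resolved pairs. In a sequence of width \<open>k\<close>, each of them meets at most \<open>k\<close> parts, which suggests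
  building every component by an expression whose labels tell the part of a vertex. The
  difficulty is that a resolution step between parts \<open>A\<close> and \<open>B\<close> must not touch the pairs resolved
  earlier, whereas a join of two labels adds all edges. The way out is to build the subgraph of the
  final graph that a component induces, including its pairs that are still unresolved. Then
  new edges are only needed when several components become one, namely for the pairs between
  different old components. None of these has been resolved before, and unresolved pairs between
  the same two parts always meet the same fate (\<open>homogeneous\<close>), so here joins of labels are
  exactly right (\<open>encoded_Un\<close>). Merging two parts only makes the requirement on the labels weaker.
\<close>

section \<open>Construction sequences as chains of narrow steps\<close>

definition initial_state :: "'a set \<Rightarrow> 'a state" where
  "initial_state V = ((\<lambda>v. {v}) ` V, {}, {})"

definition narrow :: "'a set \<Rightarrow> nat \<Rightarrow> 'a state \<Rightarrow> bool" where
  "narrow V K s \<longleftrightarrow> (\<forall>v\<in>V. card (reachable_parts s v) \<le> K)"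

definition narrow_step :: "'a set \<Rightarrow> nat \<Rightarrow> 'a state \<Rightarrow> 'a state \<Rightarrow> bool" where
  "narrow_step V K s s' \<longleftrightarrow> construction_step V s s' \<and> narrow V K s'"

text \<open>
  The next two lemmas replace lists of states by the reflexive transitive closure of
  \<open>narrow_step\<close>, so that both directions of the theorem become inductions along a chain of steps.
\<close>

lemma narrow_step_if_successively:
  assumes "successively (construction_step V) ss" "ss \<noteq> []" "\<forall>s\<in>set ss. narrow V K s"
  shows "(narrow_step V K)\<^sup>*\<^sup>* (hd ss) (last ss)"
  using assms
proof (induction ss rule: induct_list012)
  case (3 x y zs)
  then show ?case
    by (auto simp: narrow_step_def intro: converse_rtranclp_into_rtranclp[where b = y])
qed auto

lemma successively_if_narrow_step:
  assumes "(narrow_step V K)\<^sup>*\<^sup>* s t" "narrow V K s"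
  shows "\<exists>ss. ss \<noteq> [] \<and> hd ss = s \<and> last ss = t \<and>
    successively (construction_step V) ss \<and> (\<forall>x\<in>set ss. narrow V K x)"
  using assms
proof (induction rule: converse_rtranclp_induct)
  case base
  then show ?case by (intro exI[of _ "[t]"]) auto
next
  case (step s y)
  then obtain ss where "ss \<noteq> []" "hd ss = y" "last ss = t"
    "successively (construction_step V) ss" "\<forall>x\<in>set ss. narrow V K x"
    by (auto simp: narrow_step_def)
  then show ?case
    using step.hyps step.prems
    by (intro exI[of _ "s # ss"]) (auto simp: narrow_step_def successively_Cons)
qed

text \<open>
  Since a sequence has finitely many states and \<open>V\<close> is finite, the set whose least element defines
  the width is not empty; otherwise the width could be an arbitrary number.
\<close>

lemma radius_inf_width_le_iff:
  assumes "finite V"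
  shows "radius_inf_width V ss \<le> K \<longleftrightarrow> (\<forall>s\<in>set ss. narrow V K s)"
proof -
  let ?W = "\<lambda>k. \<forall>s\<in>set ss. \<forall>v\<in>V. card (reachable_parts s v) \<le> k"
  \<comment> \<open>Any common bound would do; the sum avoids a maximum over a set that may be empty.\<close>
  let ?M = "\<Sum>(s, v)\<in>set ss \<times> V. card (reachable_parts s v)"
  have "?W ?M"
  proof (intro ballI)
    fix s v
    assume "s \<in> set ss" "v \<in> V"
    then show "card (reachable_parts s v) \<le> ?M"
      using assms member_le_sum[of "(s, v)" "set ss \<times> V" "\<lambda>(s, v). card (reachable_parts s v)"]
      by auto
  qed
  then have "?W (radius_inf_width V ss)"
    unfolding radius_inf_width_def by (rule LeastI)
  moreover have "radius_inf_width V ss \<le> K" if "?W K"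
    unfolding radius_inf_width_def using that by (rule Least_le)
  ultimately show ?thesis
    unfolding narrow_def by (meson order_trans)
qed

lemma Inf_enat_le_iff: "Inf {enat (f x) | x. Q x} \<le> enat K \<longleftrightarrow> (\<exists>x. Q x \<and> f x \<le> K)"
proof
  assume "Inf {enat (f x) | x. Q x} \<le> enat K"
  then have "Inf {enat (f x) | x. Q x} < enat (Suc K)"
    by (simp add: order_le_less_trans)
  then show "\<exists>x. Q x \<and> f x \<le> K"
    unfolding Inf_less_iff by auto
next
  assume "\<exists>x. Q x \<and> f x \<le> K"
  then obtain x where "Q x" "f x \<le> K" by blast
  then show "Inf {enat (f x) | x. Q x} \<le> enat K"
    by (intro Inf_lower2[of "enat (f x)"]) auto
qed

lemma clique_width_le_iff:
  "clique_width (V, F) \<le> enat K \<longleftrightarrow> (\<exists>k\<le>K. \<exists>lab. k_expression k V F lab)"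
  using Inf_enat_le_iff[of id "\<lambda>k. \<exists>lab. k_expression k V F lab" K]
  by (auto simp: clique_width_def)

lemma mw_inf_le_iff:
  assumes "finite V"
  shows "mw_inf (V, F) \<le> enat K \<longleftrightarrow> narrow V K (initial_state V) \<and>
    (\<exists>P N. (narrow_step V K)\<^sup>*\<^sup>* (initial_state V) (P, F, N) \<and> card P \<le> 1 \<and>
      unresolved V F N = {})" (is "?L \<longleftrightarrow> ?R")
proof -
  have eq: "?L \<longleftrightarrow> (\<exists>ss. construction_sequence (V, F) ss \<and> (\<forall>s\<in>set ss. narrow V K s))"
    unfolding mw_inf_def Inf_enat_le_iff by (simp add: radius_inf_width_le_iff[OF assms])
  show ?thesis
  proof
    assume ?L
    then obtain ss where ss: "construction_sequence (V, F) ss" "\<forall>s\<in>set ss. narrow V K s"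
      unfolding eq by blast
    moreover obtain P N where "last ss = (P, F, N)" "card P \<le> 1" "unresolved V F N = {}"
      using ss(1) by (auto simp: construction_sequence_def split: prod.splits)
    moreover have "ss \<noteq> []" "hd ss = initial_state V" "successively (construction_step V) ss"
      using ss(1) by (auto simp: construction_sequence_def initial_state_def)
    ultimately show ?R
      using narrow_step_if_successively[of V ss K] by (metis list.set_sel(1))
  next
    assume ?R
    then obtain P N where *: "(narrow_step V K)\<^sup>*\<^sup>* (initial_state V) (P, F, N)"
      "narrow V K (initial_state V)" "card P \<le> 1" "unresolved V F N = {}" by blast
    show ?L
      unfolding eq using successively_if_narrow_step[OF *(1,2)] *(3,4)
      by (auto simp: construction_sequence_def initial_state_def)
  qed
qed

lemma pairs_betweenI: "a \<in> A \<Longrightarrow> b \<in> B \<Longrightarrow> {a, b} \<in> pairs_between A B"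
  by (auto simp: pairs_between_def)

lemma reachable_refl [simp]: "reachable R v v"
  by (simp add: reachable_def)

lemma reachable_edge: "{v, u} \<in> R \<Longrightarrow> reachable R v u"
  by (auto simp: reachable_def)

lemma reachable_trans: "reachable R u v \<Longrightarrow> reachable R v w \<Longrightarrow> reachable R u w"
  by (auto simp: reachable_def)

lemma reachable_sym: "reachable R u v \<Longrightarrow> reachable R v u"
proof -
  have "sym {(x, y). {x, y} \<in> R}"
    by (auto simp: sym_def insert_commute)
  then show "reachable R u v \<Longrightarrow> reachable R v u"
    by (simp add: reachable_def) (meson sym_rtrancl symD)
qed

lemma reachable_mono: "R \<subseteq> R' \<Longrightarrow> reachable R u v \<Longrightarrow> reachable R' u v"
  unfolding reachable_def using rtrancl_mono[of "{(x, y). {x, y} \<in> R}" "{(x, y). {x, y} \<in> R'}"]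
  by blast

text \<open>
  A path cannot leave a set \<open>W\<close> that no edge leaves, so inside \<open>W\<close> it only needs the edges of \<open>W\<close>.
\<close>

lemma reachable_in_closed:
  assumes "reachable R v u" "v \<in> W" "\<And>x y. {x, y} \<in> R \<Longrightarrow> x \<in> W \<Longrightarrow> {x, y} \<in> R' \<and> y \<in> W"
  shows "reachable R' v u \<and> u \<in> W"
  using assms(1) unfolding reachable_def
proof (induction rule: rtrancl_induct)
  case base
  then show ?case using assms(2) by simp
next
  case (step y z)
  then show ?case using assms(3)[of y z] by (auto intro: rtrancl_into_rtrancl)
qed

lemma narrow_initial_state:
  assumes "V = {} \<or> 0 < K"
  shows "narrow V K (initial_state V)"
proof -
  have "reachable_parts (initial_state V) v = {{v}}" if "v \<in> V" for v
    using that by (auto simp: reachable_parts_def initial_state_def reachable_def)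
  then show ?thesis
    using assms by (auto simp: narrow_def)
qed

lemma narrow_if_few_parts:
  assumes "finite P" "card P \<le> K"
  shows "narrow V K (P, E, N)"
  unfolding narrow_def
proof
  fix v
  have "card (reachable_parts (P, E, N) v) \<le> card P"
    using assms(1) by (intro card_mono) (auto simp: reachable_parts_def)
  then show "card (reachable_parts (P, E, N) v) \<le> K"
    using assms(2) by simp
qed

section \<open>From expressions to construction sequences\<close>

text \<open>
  Two constructions on disjoint vertex sets can be carried out side by side. Nothing is resolved
  between the two sides, so a vertex reaches parts of its own side only, and the width is the maximum
  of the two widths and not their sum.
\<close>

fun state_union :: "'a state \<Rightarrow> 'a state \<Rightarrow> 'a state" where
  "state_union (P, E, N) (P', E', N') = (P \<union> P', E \<union> E', N \<union> N')"

definition state_on :: "'a set \<Rightarrow> 'a state \<Rightarrow> bool" where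
  "state_on V s \<longleftrightarrow> (case s of (P, E, N) \<Rightarrow> partition_on V P \<and> E \<union> N \<subseteq> [V]\<^bsup>2\<^esup>)"

lemma part_unique:
  assumes "partition_on V P" "A \<in> P" "B \<in> P" "x \<in> A" "x \<in> B"
  shows "A = B"
  using partition_onD2[OF assms(1)] assms(2-) by (auto dest: disjointD)

lemma state_on_initial_state: "state_on V (initial_state V)"
  by (simp add: state_on_def initial_state_def partition_on_singletons)

lemma partition_on_merge:
  assumes "partition_on V P" "A \<in> P" "B \<in> P"
  shows "partition_on V (insert (A \<union> B) (P - {A, B}))"
proof (rule partition_onI)
  show "disjnt X Y" if "X \<in> insert (A \<union> B) (P - {A, B})" "Y \<in> insert (A \<union> B) (P - {A, B})" "X \<noteq> Y"
    for X Y
    unfolding disjnt_iff using that part_unique[OF assms(1)] assms(2,3) by blast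
  show "\<Union>(insert (A \<union> B) (P - {A, B})) = V"
    using assms by (auto simp: partition_on_def)
  show "{} \<notin> insert (A \<union> B) (P - {A, B})"
    using assms by (auto simp: partition_on_def)
qed

lemma state_on_step:
  assumes "construction_step V s s'" "state_on V s"
  shows "state_on V s'"
  using assms(1)
proof cases
  case (merge A P B E N)
  then show ?thesis using assms(2) partition_on_merge[of V P A B] by (simp add: state_on_def)
qed (use assms(2) in \<open>auto simp: state_on_def unresolved_def\<close>)

lemma reachable_parts_state_union:
  assumes "state_on V s" "state_on W t" "V \<inter> W = {}" "v \<in> V"
  shows "reachable_parts (state_union s t) v = reachable_parts s v"
proof -
  obtain P E N where s: "s = (P, E, N)" by (cases s)
  obtain P' E' N' where t: "t = (P', E', N')" by (cases t)
  have edges: "x \<in> V \<and> y \<in> V" if "{x, y} \<in> E \<union> N" for x y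
    using that assms(1) doubleton_in_nsets_2[of x y V] by (auto simp: s state_on_def)
  have edges': "x \<in> W \<and> y \<in> W" if "{x, y} \<in> E' \<union> N'" for x y
    using that assms(2) doubleton_in_nsets_2[of x y W] by (auto simp: t state_on_def)
  have parts: "\<Union>P = V" "\<Union>P' = W"
    using assms(1,2) by (auto simp: s t state_on_def partition_on_def)
  have "reachable (E \<union> E' \<union> (N \<union> N')) v u \<longleftrightarrow> reachable (E \<union> N) v u \<and> u \<in> V" for u
  proof
    assume "reachable (E \<union> E' \<union> (N \<union> N')) v u"
    then show "reachable (E \<union> N) v u \<and> u \<in> V"
      by (rule reachable_in_closed[OF _ assms(4)]) (use edges edges' assms(3) in blast)
  next
    assume "reachable (E \<union> N) v u \<and> u \<in> V"
    then show "reachable (E \<union> E' \<union> (N \<union> N')) v u"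
      using reachable_mono[of "E \<union> N" "E \<union> E' \<union> (N \<union> N')"] by blast
  qed
  moreover have "reachable (E \<union> N) v u \<Longrightarrow> u \<in> V" for u
    using reachable_in_closed[of "E \<union> N" v u V "E \<union> N"] edges assms(4) by blast
  ultimately show ?thesis
    using parts assms(3) by (auto simp: s t reachable_parts_def)
qed

lemma state_union_commute: "state_union s t = state_union t s"
  by (cases s; cases t) (simp add: Un_commute)

lemma narrow_state_union:
  assumes "state_on V s" "state_on W t" "V \<inter> W = {}" "narrow V K s" "narrow W K t"
  shows "narrow (V \<union> W) K (state_union s t)"
  unfolding narrow_def
proof
  fix v
  assume "v \<in> V \<union> W"
  then consider "v \<in> V" | "v \<in> W" by blast
  then show "card (reachable_parts (state_union s t) v) \<le> K"
  proof cases
    case 1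
    then show ?thesis
      using assms(4) reachable_parts_state_union[OF assms(1-3)] by (simp add: narrow_def)
  next
    case 2
    have "W \<inter> V = {}" using assms(3) by blast
    then show ?thesis
      using assms(5) 2 reachable_parts_state_union[OF assms(2,1)]
      by (simp add: narrow_def state_union_commute[of s t])
  qed
qed

lemma construction_step_state_union:
  assumes "construction_step V s s'" "state_on V s" "state_on W t" "V \<inter> W = {}"
  shows "construction_step (V \<union> W) (state_union s t) (state_union s' t)"
proof -
  obtain P' E' N' where t: "t = (P', E', N')" by (cases t)
  have unres: "pairs_between A B \<inter> unresolved (V \<union> W) (E \<union> E') (N \<union> N') =
      pairs_between A B \<inter> unresolved V E N"
    if s: "s = (P, E, N)" and AB: "A \<in> P" "B \<in> P" for P E N A B
  proof -
    have "A \<subseteq> V" "B \<subseteq> V" 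
      using AB assms(2) by (auto simp: s state_on_def partition_on_def)
    moreover have "e \<notin> E' \<union> N'" if e: "e \<in> pairs_between A B" for e
    proof -
      obtain a b where "e = {a, b}" "a \<in> A"
        using e unfolding pairs_between_def by blast
      moreover have "e \<notin> [W]\<^bsup>2\<^esup>"
        using calculation \<open>A \<subseteq> V\<close> assms(4) by auto
      ultimately show ?thesis
        using assms(3) unfolding t state_on_def by blast
    qed
    moreover have "e \<in> [V \<union> W]\<^bsup>2\<^esup> \<longleftrightarrow> e \<in> [V]\<^bsup>2\<^esup>" if "e \<in> pairs_between A B" for e
      using \<open>A \<subseteq> V\<close> \<open>B \<subseteq> V\<close> that by (auto simp: pairs_between_def)
    ultimately show ?thesis
      by (auto simp: unresolved_def)
  qed
  show ?thesis
    using assms(1)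
  proof cases
    case (merge A P B E N)
    have "A \<notin> P'" "B \<notin> P'"
    proof -
      have "A \<noteq> {}" "A \<subseteq> V" "B \<noteq> {}" "B \<subseteq> V"
        using merge assms(2) by (auto simp: state_on_def partition_on_def)
      moreover have "\<Union>P' = W"
        using assms(3) by (simp add: t state_on_def partition_on_def)
      ultimately show "A \<notin> P'" "B \<notin> P'"
        using assms(4) by blast+
    qed
    then have "insert (A \<union> B) (P - {A, B}) \<union> P' = insert (A \<union> B) (P \<union> P' - {A, B})"
      by auto
    then show ?thesis
      using merge construction_step.merge[of A "P \<union> P'" B] by (simp add: t)
  next
    case (resolve_positively A P B E N)
    then show ?thesis
      using construction_step.resolve_positively[of A "P \<union> P'" B "V \<union> W" "E \<union> E'" "N \<union> N'"]
        unres[of P E N A B] by (simp add: t Un_ac)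
  next
    case (resolve_negatively A P B E N)
    then show ?thesis
      using construction_step.resolve_negatively[of A "P \<union> P'" B "V \<union> W" "E \<union> E'" "N \<union> N'"]
        unres[of P E N A B] by (simp add: t Un_ac)
  qed
qed

lemma narrow_steps_state_union:
  assumes "(narrow_step V K)\<^sup>*\<^sup>* s s'" "state_on V s"
    "state_on W t" "narrow W K t" "V \<inter> W = {}"
  shows "(narrow_step (V \<union> W) K)\<^sup>*\<^sup>* (state_union s t) (state_union s' t)"
  using assms(1,2)
proof (induction rule: converse_rtranclp_induct)
  case (step s y)
  have y: "state_on V y"
    using step by (auto simp: narrow_step_def intro: state_on_step)
  have "narrow_step (V \<union> W) K (state_union s t) (state_union y t)"
    using step.hyps step.prems assms y
    by (auto simp: narrow_step_def intro: construction_step_state_union narrow_state_union)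
  then show ?case
    using step.IH[OF y] by (rule converse_rtranclp_into_rtranclp)
qed simp

text \<open>
  All the states in between have at most \<open>K\<close> parts in total, hence are narrow no matter which pairs
  have been resolved.
\<close>

lemma merge_to_coarser_partition:
  assumes "refines V P Q" "finite P" "card P \<le> K"
  shows "(narrow_step V K)\<^sup>*\<^sup>* (P, E, N) (Q, E, N)"
  using assms
proof (induction "card P" arbitrary: P rule: less_induct)
  case less
  have P: "partition_on V P" and Q: "partition_on V Q" and sub: "\<forall>A\<in>P. \<exists>C\<in>Q. A \<subseteq> C"
    using less.prems by (auto simp: refines_def)
  show ?case
  proof (cases "\<exists>A\<in>P. \<exists>B\<in>P. \<exists>C\<in>Q. A \<noteq> B \<and> A \<subseteq> C \<and> B \<subseteq> C")
    case True
    then obtain A B C where AB: "A \<in> P" "B \<in> P" "C \<in> Q" "A \<noteq> B" "A \<subseteq> C" "B \<subseteq> C"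
      by blast
    let ?P' = "insert (A \<union> B) (P - {A, B})"
    have "card (P - {A, B}) = card P - 2" "2 \<le> card P"
      using AB less.prems(2) card_mono[of P "{A, B}"] by (auto simp: card_Diff_subset)
    then have card: "card ?P' < card P"
      using less.prems(2) card_insert_le_m1[of "card P - 1" "P - {A, B}" "A \<union> B"] by linarith
    have ref: "refines V ?P' Q"
      using partition_on_merge[OF P AB(1,2)] Q sub AB by (auto simp: refines_def)
    have "narrow_step V K (P, E, N) (?P', E, N)"
      using construction_step.merge[OF AB(1,2,4)] less.prems card
      by (auto simp: narrow_step_def intro!: narrow_if_few_parts)
    moreover have "(narrow_step V K)\<^sup>*\<^sup>* (?P', E, N) (Q, E, N)"
      using less.prems card by (intro less.hyps[OF card ref]) auto
    ultimately show ?thesis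
      by (rule converse_rtranclp_into_rtranclp)
  next
    case False
    have "refines V Q P"
      unfolding refines_def
    proof (intro conjI ballI P Q)
      fix C
      assume C: "C \<in> Q"
      then obtain x where x: "x \<in> C" using partition_onD3[OF Q] by (metis ex_in_conv)
      then obtain A where A: "A \<in> P" "x \<in> A"
        using C P Q by (auto simp: partition_on_def)
      have "A' \<subseteq> C" if A': "A' \<in> P" "A' \<inter> C \<noteq> {}" for A'
      proof -
        obtain D where "D \<in> Q" "A' \<subseteq> D" using sub A' by blast
        then show ?thesis
          using A'(2) C part_unique[OF Q] by blast
      qed
      then have meets: "A' \<subseteq> C" if "A' \<in> P" "A' \<inter> C \<noteq> {}" for A'
        using that by blast
      have "A \<subseteq> C" using meets A x by blast
      then have "A' = A" if "A' \<in> P" "A' \<inter> C \<noteq> {}" for A'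
        using meets[OF that] that(1) False C A(1) by blast
      then have "C \<subseteq> A"
        using partition_onD1[OF P] partition_onD1[OF Q] C A by blast
      then show "\<exists>A\<in>P. C \<subseteq> A" using A by blast
    qed
    then have "P = Q" by (rule refines_asym[OF less.prems(1)])
    then show ?thesis by simp
  qed
qed

definition label_class :: "('a \<Rightarrow> nat) \<Rightarrow> 'a set \<Rightarrow> nat \<Rightarrow> 'a set" where
  "label_class lab V i = {v \<in> V. lab v = i}"

definition label_classes :: "('a \<Rightarrow> nat) \<Rightarrow> 'a set \<Rightarrow> 'a set set" where
  "label_classes lab V = label_class lab V ` lab ` V"

lemma partition_on_label_classes: "partition_on V (label_classes lab V)"
proof (rule partition_onI)
  show "disjnt A B"
    if "A \<in> label_classes lab V" "B \<in> label_classes lab V" "A \<noteq> B" for A B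
    using that by (auto simp: label_classes_def label_class_def disjnt_def)
qed (auto simp: label_classes_def label_class_def)

lemma refines_label_classes:
  assumes "partition_on V P" "\<And>A u v. A \<in> P \<Longrightarrow> u \<in> A \<Longrightarrow> v \<in> A \<Longrightarrow> lab u = lab v"
  shows "refines V P (label_classes lab V)"
  unfolding refines_def
proof (intro conjI ballI assms(1) partition_on_label_classes)
  fix A
  assume A: "A \<in> P"
  then have "A \<noteq> {}" "A \<subseteq> V" using assms(1) by (auto simp: partition_on_def)
  then obtain u where "u \<in> A" "A \<subseteq> V" by blast
  then have "label_class lab V (lab u) \<in> label_classes lab V"
    by (auto simp: label_classes_def)
  moreover have "A \<subseteq> label_class lab V (lab u)"
  proof
    fix v
    assume "v \<in> A"
    then have "lab v = lab u" using \<open>u \<in> A\<close> by (rule assms(2)[OF A])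
    then show "v \<in> label_class lab V (lab u)"
      using \<open>A \<subseteq> V\<close> \<open>v \<in> A\<close> by (auto simp: label_class_def)
  qed
  ultimately show "\<exists>C\<in>label_classes lab V. A \<subseteq> C" by blast
qed

lemma card_label_classes:
  assumes "lab ` V \<subseteq> {..<k}"
  shows "finite (label_classes lab V)" "card (label_classes lab V) \<le> k"
proof -
  have fin: "finite (lab ` V)" using assms finite_subset by blast
  then show "finite (label_classes lab V)" by (simp add: label_classes_def)
  have "card (label_classes lab V) \<le> card (lab ` V)"
    unfolding label_classes_def using fin by (rule card_image_le)
  also have "\<dots> \<le> k" using assms card_mono[of "{..<k}"] by fastforce
  finally show "card (label_classes lab V) \<le> k" .
qed

lemma label_class_constant:
  assumes "A \<in> label_classes lab V" "u \<in> A" "v \<in> A"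
  shows "lab u = lab v"
proof -
  obtain i where "A = label_class lab V i" using assms(1) by (auto simp: label_classes_def)
  then show ?thesis using assms(2,3) by (simp add: label_class_def)
qed

lemma k_expression_wf:
  assumes "k_expression k V E lab"
  shows "E \<subseteq> [V]\<^bsup>2\<^esup>" "lab ` V \<subseteq> {..<k}"
proof -
  have "E \<subseteq> [V]\<^bsup>2\<^esup> \<and> lab ` V \<subseteq> {..<k}"
    using assms
  proof induction
    case (disjoint_union V1 E1 lab1 V2 E2 lab2)
    then show ?case using nsets_mono[of V1 "V1 \<union> V2" 2] nsets_mono[of V2 "V1 \<union> V2" 2] by auto
  qed (auto simp: pairs_between_def)
  then show "E \<subseteq> [V]\<^bsup>2\<^esup>" "lab ` V \<subseteq> {..<k}" by auto
qed

text \<open>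
  The sequence follows the expression bottom-up: its parts are the label classes, a relabelling
  merges two classes, and a join resolves a pair of classes positively. Nothing is resolved
  negatively, because any pair that is not an edge yet may still become one at a later join. The
  factor 2 is due to a disjoint union: just before the classes with equal labels are merged, there
  are \<open>k\<close> of them on either side.
\<close>

lemma narrow_steps_if_k_expression:
  assumes "k_expression k V E lab"
  shows "(narrow_step V (2 * k))\<^sup>*\<^sup>* (initial_state V) (label_classes lab V, E, {})"
  using assms
proof induction
  case (empty lab)
  then show ?case by (simp add: initial_state_def label_classes_def)
next
  case (vertex i v)
  then show ?case by (simp add: initial_state_def label_classes_def label_class_def)
next
  case (disjoint_union V1 E1 lab1 V2 E2 lab2)
  let ?lab = "\<lambda>v. if v \<in> V1 then lab1 v else lab2 v"
  let ?s1 = "(label_classes lab1 V1, E1, {}) :: 'a state"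
  let ?s2 = "(label_classes lab2 V2, E2, {}) :: 'a state"
  note wf1 = k_expression_wf[OF disjoint_union.hyps(1)]
  note wf2 = k_expression_wf[OF disjoint_union.hyps(2)]
  note card1 = card_label_classes[OF wf1(2)]
  note card2 = card_label_classes[OF wf2(2)]
  have on1: "state_on V1 ?s1"
    using wf1(1) by (simp add: state_on_def partition_on_label_classes)
  have "(narrow_step (V1 \<union> V2) (2 * k))\<^sup>*\<^sup>*
      (state_union (initial_state V1) (initial_state V2)) (state_union ?s1 (initial_state V2))"
  proof (rule narrow_steps_state_union)
    show "narrow V2 (2 * k) (initial_state V2)"
      using wf2(2) by (intro narrow_initial_state) auto
  qed (use disjoint_union.IH disjoint_union.hyps(3) state_on_initial_state in auto)
  also have "(narrow_step (V1 \<union> V2) (2 * k))\<^sup>*\<^sup>*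
      (state_union ?s1 (initial_state V2)) (state_union ?s1 ?s2)"
    unfolding state_union_commute[of ?s1] Un_commute[of V1]
  proof (rule narrow_steps_state_union)
    show "narrow V1 (2 * k) ?s1"
      using card1 by (intro narrow_if_few_parts) auto
  qed (use disjoint_union.IH disjoint_union.hyps(3) state_on_initial_state on1 in auto)
  also have "(narrow_step (V1 \<union> V2) (2 * k))\<^sup>*\<^sup>* (state_union ?s1 ?s2)
      (label_classes ?lab (V1 \<union> V2), E1 \<union> E2, {})"
  proof -
    let ?P = "label_classes lab1 V1 \<union> label_classes lab2 V2"
    have sub: "\<Union>(label_classes lab1 V1) = V1" "\<Union>(label_classes lab2 V2) = V2"
      using partition_onD1[OF partition_on_label_classes] by metis+
    have "partition_on (V1 \<union> V2) ?P"
    proof (rule partition_onI)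
      fix X Y
      assume XY: "X \<in> ?P" "Y \<in> ?P" "X \<noteq> Y"
      show "disjnt X Y"
        unfolding disjnt_iff
      proof (intro allI notI, elim conjE)
        fix x
        assume x: "x \<in> X" "x \<in> Y"
        have "(X \<in> label_classes lab1 V1 \<and> Y \<in> label_classes lab1 V1) \<or>
            (X \<in> label_classes lab2 V2 \<and> Y \<in> label_classes lab2 V2)"
          using XY x sub disjoint_union.hyps(3) by blast
        then show False
          using XY(3) x part_unique[OF partition_on_label_classes, of X _ _ Y x] by auto
      qed
    next
      show "{} \<notin> ?P"
        using partition_onD3[OF partition_on_label_classes] by (metis Un_iff)
    qed (use sub in auto)
    then have "refines (V1 \<union> V2) ?P (label_classes ?lab (V1 \<union> V2))"
    proof (rule refines_label_classes)
      fix A u v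
      assume A: "A \<in> ?P" "u \<in> A" "v \<in> A"
      show "?lab u = ?lab v"
      proof (cases "A \<in> label_classes lab1 V1")
        case True
        then have "u \<in> V1" "v \<in> V1" using A sub by auto
        then show ?thesis using label_class_constant[OF True A(2,3)] by simp
      next
        case False
        then have A2: "A \<in> label_classes lab2 V2" using A by simp
        then have "u \<notin> V1" "v \<notin> V1" using A sub disjoint_union.hyps(3) by auto
        then show ?thesis using label_class_constant[OF A2 A(2,3)] by simp
      qed
    qed
    moreover have "card ?P \<le> 2 * k"
      using card1(2) card2(2) card_Un_le[of "label_classes lab1 V1" "label_classes lab2 V2"]
      by linarith
    ultimately show ?thesis
      using merge_to_coarser_partition[of "V1 \<union> V2" ?P _ "2 * k" "E1 \<union> E2" "{}"] card1(1) card2(1)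
      by simp
  qed
  finally show ?case
    by (simp add: initial_state_def image_Un)
next
  case (relabel V E lab i j)
  note wf = k_expression_wf[OF relabel.hyps(1)]
  have "refines V (label_classes lab V) (label_classes (\<lambda>v. if lab v = i then j else lab v) V)"
    by (rule refines_label_classes[OF partition_on_label_classes])
      (auto dest: label_class_constant)
  then have "(narrow_step V (2 * k))\<^sup>*\<^sup>* (label_classes lab V, E, {})
      (label_classes (\<lambda>v. if lab v = i then j else lab v) V, E, {})"
    using card_label_classes[OF wf(2)] by (intro merge_to_coarser_partition) auto
  then show ?case
    using relabel.IH by (rule rtranclp_trans[rotated])
next
  case (join V E lab i j)
  note wf = k_expression_wf[OF join.hyps(1)]
  let ?A = "{v \<in> V. lab v = i}" and ?B = "{v \<in> V. lab v = j}"
  show ?case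
  proof (cases "?A = {} \<or> ?B = {}")
    case True
    then have "pairs_between ?A ?B = {}" by (auto simp: pairs_between_def)
    then show ?thesis using join.IH by simp
  next
    case False
    then have parts: "?A \<in> label_classes lab V" "?B \<in> label_classes lab V"
      by (auto simp: label_classes_def label_class_def)
    have "pairs_between ?A ?B \<subseteq> [V]\<^bsup>2\<^esup>"
      using join.hyps(4) by (auto simp: pairs_between_def)
    then have "E \<union> (pairs_between ?A ?B \<inter> unresolved V E {}) = E \<union> pairs_between ?A ?B"
      by (auto simp: unresolved_def)
    then have "narrow_step V (2 * k) (label_classes lab V, E, {})
        (label_classes lab V, E \<union> pairs_between ?A ?B, {})"
      using construction_step.resolve_positively[OF parts, of V E "{}"] card_label_classes[OF wf(2)]
      by (auto simp: narrow_step_def intro!: narrow_if_few_parts)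
    then show ?thesis
      by (rule rtranclp.rtrancl_into_rtrancl[OF join.IH])
  qed
qed

text \<open>
  At the end of the expression all remaining pairs are non-edges for good: merging everything into
  one part makes it possible to resolve them negatively in a single step.
\<close>

lemma mw_inf_le_if_clique_width_le:
  assumes "simple_graph G" "clique_width G \<le> enat K"
  shows "mw_inf G \<le> enat (2 * K)"
proof -
  obtain V F where G: "G = (V, F)" by (cases G)
  then obtain k lab where k: "k \<le> K" "k_expression k V F lab"
    using assms(2) clique_width_le_iff by blast
  have V: "finite V" using assms(1) by (simp add: G simple_graph_def)
  note wf = k_expression_wf[OF k(2)]
  note card = card_label_classes[OF wf(2)]
  let ?s = "(label_classes lab V, F, {}) :: 'a state"
  have init: "narrow V (2 * k) (initial_state V)"
    using wf(2) by (intro narrow_initial_state) auto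
  have run: "(narrow_step V (2 * k))\<^sup>*\<^sup>* (initial_state V) ?s"
    using k(2) by (rule narrow_steps_if_k_expression)
  have "\<exists>P N. (narrow_step V (2 * k))\<^sup>*\<^sup>* (initial_state V) (P, F, N) \<and> card P \<le> 1 \<and>
      unresolved V F N = {}"
  proof (cases "V = {}")
    case True
    then show ?thesis
      using run wf(1) by (auto simp: label_classes_def unresolved_def nsets_2_eq)
  next
    case False
    then have k0: "k > 0" using wf(2) by auto
    have "refines V (label_classes lab V) {V}"
      using False partition_on_label_classes[of V lab] 
      by (auto simp: refines_def partition_on_space partition_on_def)
    then have "(narrow_step V (2 * k))\<^sup>*\<^sup>* ?s ({V}, F, {})"
      using card by (intro merge_to_coarser_partition) auto
    moreover have "narrow_step V (2 * k) ({V}, F, {}) ({V}, F, unresolved V F {})"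
    proof -
      have "pairs_between V V \<inter> unresolved V F {} = unresolved V F {}"
        by (auto simp: pairs_between_def unresolved_def nsets_2_eq)
      then show ?thesis
        using construction_step.resolve_negatively[of V "{V}" V V F "{}"] k0
        by (auto simp: narrow_step_def intro!: narrow_if_few_parts)
    qed
    ultimately have "(narrow_step V (2 * k))\<^sup>*\<^sup>* (initial_state V) ({V}, F, unresolved V F {})"
      using run by (meson rtranclp.rtrancl_into_rtrancl rtranclp_trans)
    then show ?thesis
      by (intro exI[of _ "{V}"] exI[of _ "unresolved V F {}"]) (auto simp: unresolved_def)
  qed
  then have "mw_inf G \<le> enat (2 * k)"
    unfolding G mw_inf_le_iff[OF V] using init by blast
  also have "\<dots> \<le> enat (2 * K)" using k(1) by simp
  finally show ?thesis .
qed

section \<open>From construction sequences to expressions\<close>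

text \<open>
  Sequential relabellings act like the simultaneous one if no new label is among the old ones that
  are still to be replaced.
\<close>

lemma k_expression_relabel_set:
  assumes "k_expression K X E lab" "finite S" "S \<subseteq> {..<K}" "\<phi> ` S \<subseteq> {..<K} - S"
  shows "k_expression K X E (\<lambda>v. if lab v \<in> S then \<phi> (lab v) else lab v)"
proof -
  have "k_expression K X E (\<lambda>v. if lab v \<in> T then \<phi> (lab v) else lab v)"
    if "finite T" "T \<subseteq> S" for T
    using that
  proof (induction T rule: finite_induct)
    case empty
    then show ?case using assms(1) by simp
  next
    case (insert i T)
    let ?f = "\<lambda>v. if lab v \<in> T then \<phi> (lab v) else lab v"
    have "k_expression K X E (\<lambda>v. if ?f v = i then \<phi> i else ?f v)"
      using insert.prems assms(3,4) by (intro k_expression.relabel insert.IH) auto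
    moreover have "(if ?f v = i then \<phi> i else ?f v) =
        (if lab v \<in> insert i T then \<phi> (lab v) else lab v)" for v
      using insert.prems insert.hyps(2) assms(4) by auto
    ultimately show ?case by simp
  qed
  then show ?thesis using assms(2) by blast
qed

text \<open>
  The labels from \<open>m\<close> to \<open>2 * m - 1\<close> serve as a buffer: first every label is moved there, then each
  one is sent to its target. Without a buffer, a permutation of the labels could not be performed.
\<close>

lemma k_expression_recolour:
  assumes "k_expression (2 * m) X E lab" "lab ` X \<subseteq> {..<m}" "\<phi> ` {..<m} \<subseteq> {..<m}"
  shows "\<exists>lab'. k_expression (2 * m) X E lab' \<and> (\<forall>v\<in>X. lab' v = \<phi> (lab v))"
proof -
  define lab1 where "lab1 = (\<lambda>v. if lab v \<in> {..<m} then m + lab v else lab v)"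
  define lab2 where "lab2 = (\<lambda>v. if lab1 v \<in> {m..<2 * m} then \<phi> (lab1 v - m) else lab1 v)"
  have "k_expression (2 * m) X E lab1"
    unfolding lab1_def using assms(1) by (rule k_expression_relabel_set) auto
  then have "k_expression (2 * m) X E lab2"
    unfolding lab2_def
  proof (rule k_expression_relabel_set)
    show "(\<lambda>l. \<phi> (l - m)) ` {m..<2 * m} \<subseteq> {..<2 * m} - {m..<2 * m}"
    proof
      fix l
      assume "l \<in> (\<lambda>l. \<phi> (l - m)) ` {m..<2 * m}"
      then obtain j where "j \<in> {m..<2 * m}" "l = \<phi> (j - m)" by blast
      then have "j - m < m" "l = \<phi> (j - m)" by auto
      then show "l \<in> {..<2 * m} - {m..<2 * m}" using assms(3) by auto
    qed
  qed auto
  moreover have "\<forall>v\<in>X. lab2 v = \<phi> (lab v)"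
    using assms(2) by (auto simp: lab1_def lab2_def)
  ultimately show ?thesis by blast
qed

lemma k_expression_joins:
  assumes "k_expression K X E lab" "finite J" "\<And>i j. (i, j) \<in> J \<Longrightarrow> i < K \<and> j < K \<and> i \<noteq> j"
  shows "k_expression K X
    (E \<union> (\<Union>(i, j)\<in>J. pairs_between (label_class lab X i) (label_class lab X j))) lab"
  using assms(2,3)
proof (induction J rule: finite_induct)
  case empty
  then show ?case using assms(1) by simp
next
  case (insert p J)
  obtain i j where p: "p = (i, j)" by (cases p)
  let ?E = "E \<union> (\<Union>(i, j)\<in>J. pairs_between (label_class lab X i) (label_class lab X j))"
  have "k_expression K X (?E \<union> pairs_between (label_class lab X i) (label_class lab X j)) lab"
    unfolding label_class_def[of lab X i] label_class_def[of lab X j]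
    using insert.prems[of i j] insert.prems by (intro k_expression.join insert.IH) (auto simp: p)
  then show ?case by (simp add: p Un_ac)
qed

definition touched :: "'a set set \<Rightarrow> 'a set \<Rightarrow> 'a set set" where
  "touched P X = {A \<in> P. A \<inter> X \<noteq> {}}"

text \<open>
  The expression builds the subgraph of the final graph \<open>F\<close> induced by \<open>X\<close>, and not just the edges
  resolved so far. Its labels determine the part of a vertex, so that edges leaving \<open>X\<close> can be added
  part by part. Only half of the \<open>4 * k\<close> labels occur at the end: the others are the buffer for
  recolouring.
\<close>

definition encoded :: "nat \<Rightarrow> 'a set set \<Rightarrow> 'a set set \<Rightarrow> 'a set \<Rightarrow> bool" where
  "encoded k F P X \<longleftrightarrow> (\<exists>lab. k_expression (4 * k) X (F \<inter> [X]\<^bsup>2\<^esup>) lab \<and>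
     lab ` X \<subseteq> {..<2 * k} \<and> (\<forall>u\<in>X. \<forall>v\<in>X. lab u = lab v \<longrightarrow> (\<exists>A\<in>P. u \<in> A \<and> v \<in> A)))"

text \<open>
  This is why it suffices to remember the part of a vertex: an unresolved pair between two parts will
  be resolved together with all other unresolved pairs between these parts, so all of them become
  edges or none does.
\<close>

definition homogeneous :: "'a set set \<Rightarrow> 'a set set \<Rightarrow> 'a set set \<Rightarrow> bool" where
  "homogeneous F U P \<longleftrightarrow> (\<forall>A\<in>P. \<forall>B\<in>P. \<forall>a\<in>A. \<forall>a'\<in>A. \<forall>b\<in>B. \<forall>b'\<in>B.
     {a, b} \<in> U \<longrightarrow> {a', b'} \<in> U \<longrightarrow> {a, b} \<in> F \<longrightarrow> {a', b'} \<in> F)"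

lemma homogeneousD:
  assumes "homogeneous F U P" "A \<in> P" "B \<in> P" "a \<in> A" "a' \<in> A" "b \<in> B" "b' \<in> B"
    "{a, b} \<in> U" "{a', b'} \<in> U" "{a, b} \<in> F"
  shows "{a', b'} \<in> F"
  using assms(1)[unfolded homogeneous_def, rule_format, OF assms(2-10)] .

text \<open>
  As the label determines the part, a function of the part is a function of the label, and
  recolouring can apply the latter.
\<close>

lemma encoded_recolour:
  assumes "encoded k F P X" "\<And>A u v. A \<in> P \<Longrightarrow> u \<in> A \<inter> X \<Longrightarrow> v \<in> A \<inter> X \<Longrightarrow> f u = f v"
    "f ` X \<subseteq> {..<2 * k}"
  shows "\<exists>lab. k_expression (4 * k) X (F \<inter> [X]\<^bsup>2\<^esup>) lab \<and> (\<forall>v\<in>X. lab v = f v)"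
proof -
  obtain lab where lab: "k_expression (2 * (2 * k)) X (F \<inter> [X]\<^bsup>2\<^esup>) lab" "lab ` X \<subseteq> {..<2 * k}"
    and same: "\<And>u v. u \<in> X \<Longrightarrow> v \<in> X \<Longrightarrow> lab u = lab v \<Longrightarrow> \<exists>A\<in>P. u \<in> A \<and> v \<in> A"
    using assms(1) by (auto simp: encoded_def)
  \<comment> \<open>Being the identity on labels that do not occur keeps \<open>\<phi>\<close> inside \<open>{..<2 * k}\<close> even for \<open>k = 0\<close>.\<close>
  define \<phi> where "\<phi> l = (if l \<in> lab ` X then f (SOME v. v \<in> X \<and> lab v = l) else l)" for l
  have \<phi>: "\<phi> (lab v) = f v" if v: "v \<in> X" for v
  proof -
    let ?u = "SOME u. u \<in> X \<and> lab u = lab v"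
    have "?u \<in> X \<and> lab ?u = lab v" 
      using someI[of "\<lambda>u. u \<in> X \<and> lab u = lab v" v] that by simp
    then obtain A where "A \<in> P" "?u \<in> A \<inter> X" "v \<in> A \<inter> X"
      using same[of ?u v] v by blast
    then have "f ?u = f v" by (rule assms(2))
    then show ?thesis using that by (simp add: \<phi>_def)
  qed
  have "\<phi> l < 2 * k" if "l < 2 * k" for l
  proof (cases "l \<in> lab ` X")
    case True
    then show ?thesis using \<phi> assms(3) by auto
  qed (use that in \<open>simp add: \<phi>_def\<close>)
  then obtain lab' where "k_expression (2 * (2 * k)) X (F \<inter> [X]\<^bsup>2\<^esup>) lab'"
    "\<forall>v\<in>X. lab' v = \<phi> (lab v)"
    using k_expression_recolour[OF lab, of \<phi>] by blast
  then show ?thesis using \<phi> by auto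
qed

lemma part_numbering:
  assumes "partition_on V P" "finite V" "X \<subseteq> V" "card (touched P X) \<le> k"
  obtains f :: "'a \<Rightarrow> nat" where "f ` X \<subseteq> {..<k}"
    "\<And>u v. u \<in> X \<Longrightarrow> v \<in> X \<Longrightarrow> f u = f v \<longleftrightarrow> (\<exists>A\<in>P. u \<in> A \<and> v \<in> A)"
proof -
  have "finite (touched P X)"
    using finite_elements[OF assms(2,1)] by (simp add: touched_def)
  then obtain g where "bij_betw g (touched P X) {0..<card (touched P X)}"
    using ex_bij_betw_finite_nat by metis
  then have g: "g ` touched P X \<subseteq> {..<k}" "inj_on g (touched P X)"
    using assms(4) by (auto simp: bij_betw_def)
  define part where "part v = (THE A. A \<in> P \<and> v \<in> A)" for v
  have part: "part v = A" if "A \<in> P" "v \<in> A" for v A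
    unfolding part_def
  proof (rule the_equality)
    show "B = A" if "B \<in> P \<and> v \<in> B" for B
      using that \<open>A \<in> P\<close> \<open>v \<in> A\<close> part_unique[OF assms(1)] by metis
  qed (use that in simp)
  have in_part: "part v \<in> touched P X \<and> v \<in> part v" if v: "v \<in> X" for v
  proof -
    obtain A where "A \<in> P" "v \<in> A" using v assms(1,3) by (auto simp: partition_on_def)
    then show ?thesis using part[of A v] that by (auto simp: touched_def)
  qed
  show thesis
  proof (rule that[of "\<lambda>v. g (part v)"])
    show "(\<lambda>v. g (part v)) ` X \<subseteq> {..<k}"
      using in_part g(1) by blast
  next
    fix u v
    assume uv: "u \<in> X" "v \<in> X"
    have "g (part u) = g (part v) \<longleftrightarrow> part u = part v"
      using inj_on_eq_iff[OF g(2)] in_part uv by blast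
    also have "\<dots> \<longleftrightarrow> (\<exists>A\<in>P. u \<in> A \<and> v \<in> A)"
      using part in_part[OF uv(1)] in_part[OF uv(2)] by (auto simp: touched_def)
    finally show "g (part u) = g (part v) \<longleftrightarrow> (\<exists>A\<in>P. u \<in> A \<and> v \<in> A)" .
  qed
qed

text \<open>
  Number the at most \<open>k\<close> parts that are met. With the labels \<open>0, \<dots>, k - 1\<close> for the vertices of \<open>X\<close>
  and \<open>k, \<dots>, 2 * k - 1\<close> for those of \<open>Y\<close>, joins of a label of the first kind with one of the second
  kind add edges between \<open>X\<close> and \<open>Y\<close> only. All these pairs are in \<open>U\<close>, so homogeneity says that a
  label class in \<open>X\<close> and one in \<open>Y\<close> are completely joined in \<open>F\<close> or not joined at all.
\<close>

lemma encoded_Un: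
  assumes "partition_on V P" "finite V" "X \<union> Y \<subseteq> V" "X \<inter> Y = {}"
    and U: "pairs_between X Y \<subseteq> U" "homogeneous F U P"
    and card: "card (touched P (X \<union> Y)) \<le> k"
    and enc: "encoded k F P X" "encoded k F P Y"
  shows "encoded k F P (X \<union> Y)"
proof -
  obtain f where f: "f ` (X \<union> Y) \<subseteq> {..<k}"
    and part: "\<And>u v. u \<in> X \<union> Y \<Longrightarrow> v \<in> X \<union> Y \<Longrightarrow> f u = f v \<longleftrightarrow> (\<exists>A\<in>P. u \<in> A \<and> v \<in> A)"
    using part_numbering[OF assms(1-3) card] by metis
  obtain lab1 where lab1: "k_expression (4 * k) X (F \<inter> [X]\<^bsup>2\<^esup>) lab1" "\<forall>v\<in>X. lab1 v = f v"
    using encoded_recolour[OF enc(1), of f] part f by fastforce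
  obtain lab2 where lab2: "k_expression (4 * k) Y (F \<inter> [Y]\<^bsup>2\<^esup>) lab2" "\<forall>v\<in>Y. lab2 v = k + f v"
    using encoded_recolour[OF enc(2), of "\<lambda>v. k + f v"] part f by fastforce
  define lab where "lab = (\<lambda>v. if v \<in> X then lab1 v else lab2 v)"
  define J where "J = {(f x, k + f y) | x y. x \<in> X \<and> y \<in> Y \<and> {x, y} \<in> F}"
  have labX: "lab v = f v \<and> f v < k" if "v \<in> X" for v
    using that lab1(2) f by (auto simp: lab_def)
  have labY: "lab v = k + f v \<and> f v < k" if "v \<in> Y" for v
    using that lab2(2) f assms(4) by (auto simp: lab_def)
  have "J \<subseteq> {..<k} \<times> {k..<2 * k}"
    using labX labY by (fastforce simp: J_def)
  then have "finite J" by (rule finite_subset) simp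
  moreover have "i < 4 * k \<and> j < 4 * k \<and> i \<noteq> j" if "(i, j) \<in> J" for i j
    using that \<open>J \<subseteq> {..<k} \<times> {k..<2 * k}\<close> by fastforce
  moreover have "k_expression (4 * k) (X \<union> Y) (F \<inter> [X]\<^bsup>2\<^esup> \<union> F \<inter> [Y]\<^bsup>2\<^esup>) lab"
    unfolding lab_def using lab1(1) lab2(1) assms(4) by (rule k_expression.disjoint_union)
  ultimately have "k_expression (4 * k) (X \<union> Y) (F \<inter> [X]\<^bsup>2\<^esup> \<union> F \<inter> [Y]\<^bsup>2\<^esup> \<union>
      (\<Union>(i, j)\<in>J. pairs_between (label_class lab (X \<union> Y) i) (label_class lab (X \<union> Y) j))) lab"
    (is "k_expression _ _ (_ \<union> ?C) _")
    by (intro k_expression_joins)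
  moreover have "F \<inter> [X]\<^bsup>2\<^esup> \<union> F \<inter> [Y]\<^bsup>2\<^esup> \<union> ?C = F \<inter> [X \<union> Y]\<^bsup>2\<^esup>"
  proof (intro equalityI subsetI)
    fix e
    assume "e \<in> F \<inter> [X]\<^bsup>2\<^esup> \<union> F \<inter> [Y]\<^bsup>2\<^esup> \<union> ?C"
    then consider "e \<in> F \<inter> [X]\<^bsup>2\<^esup>" | "e \<in> F \<inter> [Y]\<^bsup>2\<^esup>" | "e \<in> ?C" by blast
    then show "e \<in> F \<inter> [X \<union> Y]\<^bsup>2\<^esup>"
    proof cases
      case 1
      then show ?thesis using nsets_mono[of X "X \<union> Y" 2] by auto
    next
      case 2
      then show ?thesis using nsets_mono[of Y "X \<union> Y" 2] by auto
    next
      case 3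
      then obtain x y a b where xy: "x \<in> X" "y \<in> Y" "{x, y} \<in> F"
        and e: "e = {a, b}" and ab: "a \<in> X \<union> Y" "lab a = f x" "b \<in> X \<union> Y" "lab b = k + f y"
        by (auto simp: J_def pairs_between_def label_class_def)
      have aX: "a \<in> X" using ab(1,2) labX[OF xy(1)] labY[of a] by auto
      have bY: "b \<in> Y" using ab(3,4) labX[of b] labY[OF xy(2)] by auto
      obtain A B where AB: "A \<in> P" "B \<in> P" "x \<in> A" "a \<in> A" "y \<in> B" "b \<in> B"
        using part[of x a] part[of y b] xy ab aX bY labX[OF aX] labY[OF bY] by auto
      have "{x, y} \<in> U" "{a, b} \<in> U"
        using U(1) pairs_betweenI[OF xy(1,2)] pairs_betweenI[OF aX bY] by blast+
      then have "e \<in> F"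
        using homogeneousD[OF U(2) AB] xy(3) by (simp add: e)
      then show ?thesis using aX bY assms(4) by (auto simp: e)
    qed
  next
    fix e
    assume e: "e \<in> F \<inter> [X \<union> Y]\<^bsup>2\<^esup>"
    then obtain a b where ab: "e = {a, b}" "a \<in> X \<union> Y" "b \<in> X \<union> Y" "a \<noteq> b"
      by (auto simp: nsets_2_eq)
    have cross: "e \<in> ?C" if "x \<in> X" "y \<in> Y" "e = {x, y}" for x y
    proof -
      have "(f x, k + f y) \<in> J" using that e by (auto simp: J_def)
      moreover have "e \<in> pairs_between (label_class lab (X \<union> Y) (f x))
          (label_class lab (X \<union> Y) (k + f y))"
        unfolding that(3) using that(1,2) labX[OF that(1)] labY[OF that(2)]
        by (intro pairs_betweenI) (simp_all add: label_class_def)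
      ultimately show ?thesis by blast
    qed
    consider "a \<in> X" "b \<in> X" | "a \<in> Y" "b \<in> Y" | "a \<in> X" "b \<in> Y" | "b \<in> X" "a \<in> Y"
      using ab by blast
    then show "e \<in> F \<inter> [X]\<^bsup>2\<^esup> \<union> F \<inter> [Y]\<^bsup>2\<^esup> \<union> ?C"
    proof cases
      case 3
      then show ?thesis using cross[OF 3 ab(1)] by blast
    next
      case 4
      then show ?thesis using cross[OF 4] ab(1) by blast
    qed (use e ab in auto)
  qed
  moreover have "lab ` (X \<union> Y) \<subseteq> {..<2 * k}"
    using labX labY by fastforce
  moreover have "\<exists>A\<in>P. u \<in> A \<and> v \<in> A" if "u \<in> X \<union> Y" "v \<in> X \<union> Y" "lab u = lab v" for u v
  proof -
    have "f u = f v"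
      using that labX[of u] labX[of v] labY[of u] labY[of v] by auto
    then show ?thesis using part that by blast
  qed
  ultimately show ?thesis
    unfolding encoded_def by auto
qed

definition component :: "'a set set \<Rightarrow> 'a \<Rightarrow> 'a set" where
  "component R v = {u. reachable R v u}"

lemma component_self: "v \<in> component R v"
  by (simp add: component_def)

lemma component_eq: "u \<in> component R v \<Longrightarrow> component R u = component R v"
  using reachable_trans reachable_sym unfolding component_def by fast

lemma component_subset:
  assumes "R \<subseteq> [V]\<^bsup>2\<^esup>" "v \<in> V"
  shows "component R v \<subseteq> V"
proof
  fix u
  assume "u \<in> component R v"
  then have "reachable R v u" by (simp add: component_def)
  then have "reachable R v u \<and> u \<in> V"
    by (rule reachable_in_closed[OF _ assms(2)]) (use assms(1) in auto)
  then show "u \<in> V" by blast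
qed

lemma reachable_parts_eq: "reachable_parts (P, E, N) v = touched P (component (E \<union> N) v)"
  by (auto simp: reachable_parts_def touched_def component_def)

text \<open>
  Pairs between different components of the resolved graph are unresolved, so the components can be
  put together one at a time.
\<close>

lemma encoded_Union_components:
  assumes P: "partition_on V P" "finite V" and R: "R \<subseteq> [V]\<^bsup>2\<^esup>"
    and hom: "homogeneous F ([V]\<^bsup>2\<^esup> - R) P"
    and enc: "\<And>v. v \<in> V \<Longrightarrow> encoded k F P (component R v)"
    and W: "W \<subseteq> V" "card (touched P (\<Union>(component R ` W))) \<le> k"
  shows "encoded k F P (\<Union>(component R ` W))"
proof -
  have "finite W" using W(1) P(2) finite_subset by blast
  then show ?thesis
    using W
  proof (induction W rule: finite_induct)
    case empty
    have "encoded k F P {}"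
      using k_expression.empty by (auto simp: encoded_def nsets_2_eq)
    then show ?case by simp
  next
    case (insert w W)
    let ?X = "\<Union>(component R ` W)" and ?Y = "component R w"
    have sub: "?X \<union> ?Y \<subseteq> V"
      using insert.prems(1) component_subset[OF R] by blast
    have card: "card (touched P (?X \<union> ?Y)) \<le> k"
      using insert.prems(2) by (simp add: Un_commute)
    have "card (touched P ?X) \<le> card (touched P (?X \<union> ?Y))"
      using finite_elements[OF P(2,1)] by (intro card_mono) (auto simp: touched_def)
    then have encX: "encoded k F P ?X"
      using card insert.IH insert.prems(1) by simp
    show ?case
    proof (cases "?X \<inter> ?Y = {}")
      case True
      have "pairs_between ?X ?Y \<subseteq> [V]\<^bsup>2\<^esup> - R"
      proof
        fix e
        assume "e \<in> pairs_between ?X ?Y"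
        then obtain a b where ab: "e = {a, b}" "a \<in> ?X" "b \<in> ?Y"
          by (auto simp: pairs_between_def)
        then have "a \<noteq> b" "a \<in> V" "b \<in> V" using True sub by auto
        moreover have "{a, b} \<notin> R"
        proof
          assume "{a, b} \<in> R"
          then have "b \<in> component R a" by (simp add: component_def reachable_edge)
          moreover obtain x where "x \<in> W" "a \<in> component R x" using ab(2) by blast
          ultimately have "b \<in> ?X" using component_eq[of a R x] by blast
          then show False using ab(3) True by blast
        qed
        ultimately show "e \<in> [V]\<^bsup>2\<^esup> - R" by (simp add: ab(1))
      qed
      then have "encoded k F P (?X \<union> ?Y)"
        using encoded_Un[OF P sub True _ hom card encX] enc[of w] insert.prems(1) by blast
      then show ?thesis by (simp add: Un_commute)
    next
      case False
      then obtain u x where "x \<in> W" "u \<in> component R x" "u \<in> ?Y" by blast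
      then have "?Y = component R x" using component_eq[of u R w] component_eq[of u R x] by simp
      then have "\<Union>(component R ` insert w W) = ?X" using \<open>x \<in> W\<close> by auto
      then show ?thesis using encX by simp
    qed
  qed
qed

text \<open>
  The sets of edges and non-edges only grow, and homogeneity holds trivially once everything is
  resolved; so all these properties are obtained by going backwards from the final state.
\<close>

definition consistent_with :: "'a set set \<Rightarrow> 'a set \<Rightarrow> 'a state \<Rightarrow> bool" where
  "consistent_with F V s \<longleftrightarrow> (case s of (P, E, N) \<Rightarrow>
     E \<subseteq> F \<and> N \<inter> F = {} \<and> homogeneous F (unresolved V E N) P)"

text \<open>
  Consequently, a resolution step treats two pairs between the same two parts alike.
\<close>

lemma pair_between_parts_iff:
  assumes "partition_on V P" "A \<in> P" "B \<in> P" "C \<in> P" "D \<in> P" "c \<in> C" "d \<in> D"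
  shows "{c, d} \<in> pairs_between A B \<longleftrightarrow> {C, D} = {A, B}"
proof
  assume "{c, d} \<in> pairs_between A B"
  then obtain a b where "{c, d} = {a, b}" "a \<in> A" "b \<in> B"
    by (auto simp: pairs_between_def)
  then have "c \<in> A \<and> d \<in> B \<or> c \<in> B \<and> d \<in> A" by (auto simp: doubleton_eq_iff)
  then show "{C, D} = {A, B}"
  proof
    assume "c \<in> A \<and> d \<in> B"
    then have "C = A" "D = B" using part_unique[OF assms(1)] assms(2-) by metis+
    then show ?thesis by simp
  next
    assume "c \<in> B \<and> d \<in> A"
    then have "C = B" "D = A" using part_unique[OF assms(1)] assms(2-) by metis+
    then show ?thesis by (simp add: insert_commute)
  qed
next
  assume "{C, D} = {A, B}"
  then have "c \<in> A \<and> d \<in> B \<or> c \<in> B \<and> d \<in> A"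
    using assms(6,7) by (auto simp: doubleton_eq_iff)
  then show "{c, d} \<in> pairs_between A B"
    using pairs_betweenI[of c A d B] pairs_betweenI[of d A c B] by (auto simp: insert_commute)
qed

lemma homogeneous_before_resolving:
  assumes P: "partition_on V P" "A \<in> P" "B \<in> P"
    and hom: "homogeneous F (U - pairs_between A B) P"
    and D: "pairs_between A B \<inter> U \<subseteq> F \<or> pairs_between A B \<inter> U \<inter> F = {}"
  shows "homogeneous F U P"
  unfolding homogeneous_def
proof (intro ballI impI)
  fix C D c c' d d'
  assume *: "C \<in> P" "D \<in> P" "c \<in> C" "c' \<in> C" "d \<in> D" "d' \<in> D"
    "{c, d} \<in> U" "{c', d'} \<in> U" "{c, d} \<in> F"
  have "{c, d} \<in> pairs_between A B \<longleftrightarrow> {c', d'} \<in> pairs_between A B"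
    using pair_between_parts_iff[OF P *(1,2)] *(3-6) by simp
  then show "{c', d'} \<in> F"
    using D *(7-9) homogeneousD[OF hom *(1-6)] by blast
qed

text \<open>
  Going backwards, a merge step refines the partition.
\<close>

lemma homogeneous_coarser:
  assumes "homogeneous F U Q" "\<And>C. C \<in> P \<Longrightarrow> \<exists>D\<in>Q. C \<subseteq> D"
  shows "homogeneous F U P"
  unfolding homogeneous_def
proof (intro ballI impI)
  fix C D c c' d d'
  assume *: "C \<in> P" "D \<in> P" "c \<in> C" "c' \<in> C" "d \<in> D" "d' \<in> D"
    "{c, d} \<in> U" "{c', d'} \<in> U" "{c, d} \<in> F"
  obtain C' D' where "C' \<in> Q" "C \<subseteq> C'" "D' \<in> Q" "D \<subseteq> D'"
    using assms(2) *(1,2) by meson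
  then show "{c', d'} \<in> F"
    using homogeneousD[OF assms(1), of C' D' c c' d d'] * by blast
qed

lemma consistent_with_step_back:
  assumes "construction_step V s s'" "state_on V s" "consistent_with F V s'"
  shows "consistent_with F V s"
  using assms(1)
proof cases
  case (merge A P B E N)
  then have "homogeneous F (unresolved V E N) (insert (A \<union> B) (P - {A, B}))"
    using assms(3) by (simp add: consistent_with_def)
  then have "homogeneous F (unresolved V E N) P"
    by (rule homogeneous_coarser) auto
  then show ?thesis
    using assms(3) merge by (simp add: consistent_with_def)
next
  case (resolve_positively A P B E N)
  have c: "E \<union> (pairs_between A B \<inter> unresolved V E N) \<subseteq> F" "N \<inter> F = {}"
    "homogeneous F (unresolved V (E \<union> (pairs_between A B \<inter> unresolved V E N)) N) P"
    using assms(3) resolve_positively by (auto simp: consistent_with_def)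
  have "unresolved V (E \<union> (pairs_between A B \<inter> unresolved V E N)) N =
      unresolved V E N - pairs_between A B"
    by (auto simp: unresolved_def)
  then have "homogeneous F (unresolved V E N) P"
    using c assms(2) resolve_positively
    by (auto simp: state_on_def intro: homogeneous_before_resolving[of V P A B])
  then show ?thesis
    using c resolve_positively by (simp add: consistent_with_def)
next
  case (resolve_negatively A P B E N)
  have c: "E \<subseteq> F" "(N \<union> (pairs_between A B \<inter> unresolved V E N)) \<inter> F = {}"
    "homogeneous F (unresolved V E (N \<union> (pairs_between A B \<inter> unresolved V E N))) P"
    using assms(3) resolve_negatively by (auto simp: consistent_with_def)
  have "unresolved V E (N \<union> (pairs_between A B \<inter> unresolved V E N)) =
      unresolved V E N - pairs_between A B"
    by (auto simp: unresolved_def)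
  then have "homogeneous F (unresolved V E N) P"
    using c assms(2) resolve_negatively
    by (auto simp: state_on_def intro: homogeneous_before_resolving[of V P A B])
  then show ?thesis
    using c resolve_negatively by (auto simp: consistent_with_def)
qed

text \<open>
  The invariant that is carried forwards along a construction sequence. For the initial state it
  says that single vertices are values of expressions; in the final state \<open>V\<close> is a component, so it
  yields an expression for the whole graph.
\<close>

definition components_encoded :: "nat \<Rightarrow> 'a set set \<Rightarrow> 'a set \<Rightarrow> 'a state \<Rightarrow> bool" where
  "components_encoded k F V s \<longleftrightarrow> (case s of (P, E, N) \<Rightarrow>
     \<forall>v\<in>V. encoded k F P (component (E \<union> N) v))"

lemma encoded_coarser:
  assumes "encoded k F P X" "\<And>A. A \<in> P \<Longrightarrow> \<exists>B\<in>Q. A \<subseteq> B"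
  shows "encoded k F Q X"
proof -
  obtain lab where lab: "k_expression (4 * k) X (F \<inter> [X]\<^bsup>2\<^esup>) lab" "lab ` X \<subseteq> {..<2 * k}"
    "\<forall>u\<in>X. \<forall>v\<in>X. lab u = lab v \<longrightarrow> (\<exists>A\<in>P. u \<in> A \<and> v \<in> A)"
    using assms(1) unfolding encoded_def by blast
  have "\<forall>u\<in>X. \<forall>v\<in>X. lab u = lab v \<longrightarrow> (\<exists>A\<in>Q. u \<in> A \<and> v \<in> A)"
    using lab(3) assms(2) by (meson subsetD)
  then show ?thesis using lab(1,2) unfolding encoded_def by blast
qed

text \<open>
  The width bounds the number of parts met by a component of the new state, and this component is a
  union of old ones. The homogeneity that is needed is the one before the step, since the pairs
  between the old components are unresolved at that time.
\<close>

lemma components_encoded_more_resolved: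
  assumes on: "state_on V (P, E, N)" "state_on V (P, E', N')" "finite V"
    and more: "E \<union> N \<subseteq> E' \<union> N'"
    and hom: "homogeneous F (unresolved V E N) P"
    and "narrow V k (P, E', N')" "components_encoded k F V (P, E, N)"
  shows "components_encoded k F V (P, E', N')"
  unfolding components_encoded_def prod.case
proof
  fix v
  assume v: "v \<in> V"
  let ?R = "E \<union> N" and ?W = "component (E' \<union> N') v"
  have "component ?R u \<subseteq> ?W" if "u \<in> ?W" for u
    using that reachable_mono[OF more] reachable_trans[of "E' \<union> N'" v u]
    unfolding component_def by blast
  then have W: "\<Union>(component ?R ` ?W) = ?W"
    using component_self by fast
  have "card (touched P ?W) \<le> k"
    using assms(6) v by (simp add: narrow_def reachable_parts_eq)
  moreover have "?W \<subseteq> V"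
    using on(2) v by (intro component_subset) (simp_all add: state_on_def)
  ultimately have "encoded k F P (\<Union>(component ?R ` ?W))"
    using on(1) hom assms(3,7) encoded_Union_components[of V P ?R F k ?W]
    by (simp add: state_on_def unresolved_def components_encoded_def W)
  then show "encoded k F P ?W" by (simp only: W)
qed

lemma components_encoded_step:
  assumes "construction_step V s s'" "state_on V s" "finite V" "narrow V k s'"
    "consistent_with F V s" "components_encoded k F V s"
  shows "components_encoded k F V s'"
proof -
  have on': "state_on V s'" using assms(1,2) by (rule state_on_step)
  show ?thesis
    using assms(1)
  proof cases
    case (merge A P B E N)
    have "encoded k F (insert (A \<union> B) (P - {A, B})) X" if "encoded k F P X" for X
      using that by (rule encoded_coarser) auto
    then show ?thesis
      using assms(6) merge by (simp add: components_encoded_def)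
  next
    case (resolve_positively A P B E N)
    show ?thesis
      unfolding resolve_positively(2)
    proof (rule components_encoded_more_resolved)
      show "state_on V (P, E, N)" "homogeneous F (unresolved V E N) P"
        "components_encoded k F V (P, E, N)"
        using assms resolve_positively by (simp_all add: consistent_with_def)
    qed (use assms(3,4) on' resolve_positively in auto)
  next
    case (resolve_negatively A P B E N)
    show ?thesis
      unfolding resolve_negatively(2)
    proof (rule components_encoded_more_resolved)
      show "state_on V (P, E, N)" "homogeneous F (unresolved V E N) P"
        "components_encoded k F V (P, E, N)"
        using assms resolve_negatively by (simp_all add: consistent_with_def)
    qed (use assms(3,4) on' resolve_negatively in auto)
  qed
qed

text \<open>
  One induction serves for both invariants: consistency travels backwards from \<open>t\<close>, and each forward
  step of \<open>components_encoded\<close> uses the consistency of the state in which it starts.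
\<close>

lemma components_encoded_steps:
  assumes "(narrow_step V k)\<^sup>*\<^sup>* s t" "state_on V s" "finite V" "consistent_with F V t"
  shows "consistent_with F V s \<and> (components_encoded k F V s \<longrightarrow> components_encoded k F V t)"
  using assms(1,2)
proof (induction rule: converse_rtranclp_induct)
  case base
  then show ?case using assms(4) by blast
next
  case (step s y)
  then have "construction_step V s y" "narrow V k y" by (auto simp: narrow_step_def)
  moreover have "consistent_with F V y \<and> (components_encoded k F V y \<longrightarrow> components_encoded k F V t)"
    using step.IH step.prems calculation(1) state_on_step by blast
  ultimately show ?case
    using step.prems assms(3) consistent_with_step_back components_encoded_step by blast
qed

lemma components_encoded_initial_state:
  assumes "0 < k"
  shows "components_encoded k F V (initial_state V)"
proof -
  have "component {} v = {v}" for v :: 'a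
    by (auto simp: component_def reachable_def)
  moreover have "encoded k F ((\<lambda>v. {v}) ` V) {v}" if "v \<in> V" for v
  proof -
    have "[{v}]\<^bsup>2\<^esup> = {}" by (simp add: nsets_2_eq)
    then show ?thesis
      unfolding encoded_def using assms that
      by (intro exI[of _ "\<lambda>_. 0"]) (auto intro: k_expression.vertex)
  qed
  ultimately show ?thesis
    by (simp add: components_encoded_def initial_state_def)
qed

text \<open>
  Disjointness of edges and non-edges makes the final state consistent with its own edge set.
\<close>

lemma resolved_disjoint_steps:
  assumes "(narrow_step V k)\<^sup>*\<^sup>* (initial_state V) (P, E, N)"
  shows "E \<inter> N = {} \<and> state_on V (P, E, N)"
proof -
  have "(case s of (P, E, N) \<Rightarrow> E \<inter> N = {}) \<and> state_on V s"
    if "(narrow_step V k)\<^sup>*\<^sup>* (initial_state V) s" for s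
    using that
  proof (induction rule: rtranclp_induct)
    case base
    then show ?case using state_on_initial_state by (auto simp: initial_state_def)
  next
    case (step s t)
    have st: "construction_step V s t" using step.hyps(2) by (simp add: narrow_step_def)
    then have "case t of (P, E, N) \<Rightarrow> E \<inter> N = {}"
      using step.IH by cases (auto simp: unresolved_def)
    then show ?case using st step.IH state_on_step by blast
  qed
  then show ?thesis using assms by fastforce
qed

lemma clique_width_le_if_mw_inf_le:
  assumes "simple_graph G" "mw_inf G \<le> enat k"
  shows "clique_width G \<le> enat (4 * k)"
proof -
  obtain V F where G: "G = (V, F)" by (cases G)
  have V: "finite V" and F: "F \<subseteq> [V]\<^bsup>2\<^esup>" using assms(1) by (simp_all add: G simple_graph_def)
  obtain P N where run: "(narrow_step V k)\<^sup>*\<^sup>* (initial_state V) (P, F, N)"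
    and init: "narrow V k (initial_state V)" and fin: "unresolved V F N = {}"
    using assms(2) mw_inf_le_iff[OF V] unfolding G by blast
  have "\<exists>lab. k_expression (4 * k) V F lab"
  proof (cases "V = {}")
    case True
    then show ?thesis using F k_expression.empty by (auto simp: nsets_2_eq)
  next
    case False
    then obtain v where v: "v \<in> V" by blast
    have "reachable_parts (initial_state V) v \<noteq> {}"
      using v by (auto simp: reachable_parts_def initial_state_def intro: reachable_refl)
    moreover have "finite (reachable_parts (initial_state V) v)"
      using V by (simp add: reachable_parts_def initial_state_def)
    ultimately have "0 < k"
      using init v by (metis card_gt_0_iff narrow_def order_less_le_trans)
    have "consistent_with F V (P, F, N)"
      using resolved_disjoint_steps[OF run] fin
      by (auto simp: consistent_with_def homogeneous_def)
    then have "components_encoded k F V (P, F, N)"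
      using components_encoded_steps[OF run state_on_initial_state V]
        components_encoded_initial_state[OF \<open>0 < k\<close>] by blast
    moreover have "component (F \<union> N) v = V"
    proof
      show "component (F \<union> N) v \<subseteq> V"
        using resolved_disjoint_steps[OF run] v
        by (intro component_subset) (simp_all add: state_on_def)
      show "V \<subseteq> component (F \<union> N) v"
      proof
        fix u
        assume "u \<in> V"
        then have "u = v \<or> {v, u} \<in> F \<union> N"
          using fin v doubleton_in_nsets_2[of v u V] unfolding unresolved_def by blast
        then show "u \<in> component (F \<union> N) v"
          by (auto simp: component_def intro: reachable_edge)
      qed
    qed
    ultimately have "encoded k F P V"
      using v by (auto simp: components_encoded_def)
    then show ?thesis using F by (auto simp: encoded_def Int_absorb2)
  qed
  then show ?thesis unfolding G clique_width_le_iff by blast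
qed

theorem theorem7p1:
  fixes C :: "'a graph set"
  assumes "\<forall>G\<in>C. simple_graph G"
  shows "bounded_clique_width C \<longleftrightarrow> (SUP G\<in>C. mw_inf G) < \<infinity>"
proof
  assume "bounded_clique_width C"
  then obtain k where "\<forall>G\<in>C. clique_width G \<le> enat k"
    by (auto simp: bounded_clique_width_def)
  then have "(SUP G\<in>C. mw_inf G) \<le> enat (2 * k)"
    using assms mw_inf_le_if_clique_width_le by (intro SUP_least) blast
  then show "(SUP G\<in>C. mw_inf G) < \<infinity>"
    using enat_ord_simps(4) order_le_less_trans by blast
next
  assume "(SUP G\<in>C. mw_inf G) < \<infinity>"
  then obtain k where "(SUP G\<in>C. mw_inf G) = enat k"
    by (metis less_infinityE)
  then have "\<forall>G\<in>C. mw_inf G \<le> enat k"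
    by (metis SUP_upper)
  then show "bounded_clique_width C"
    using assms clique_width_le_if_mw_inf_le unfolding bounded_clique_width_def by blast
qed

end
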